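(* Let $\mu_{12},\mu_{13},\mu_{23}$ be Borel probability measures on $[0,1]^2$ such that the set $\Pi(\mu_{12},\mu_{23},\mu_{13})$ of Borel probability measures on $[0,1]^3$ with projections $\mu_{12},\mu_{13},\mu_{23}$ onto the $xy$-, $xz$- and $yz$-planes, respectively, is non-empty. Let $\pi$ be a solution of the maximization problem $$\int_{[0,1]^3}xyz\,d\pi\to\max,\qquad \pi\in\Pi(\mu_{12},\mu_{23},\mu_{13}).$$ Then there exists a cyclical monotone set $\Gamma\subset\mathbb{R}^3$ with $\pi(\Gamma)=1$.
   Context: For a finite non-empty set $G\subset\mathbb{R}^3$ let $\pi_G$ be the uniform probability measure on $G$. A finite set $G'\subset\mathbb{R}^3$ is called a competitor of $G$ if $\pi_G$ and $\pi_{G'}$ have the same projections (push-forwards) onto the $xy$-, $yz$- and $xz$-coordinate planes. A set $\Gamma\subset\mathbb{R}^3$ is called cyclical monotone if for every natural $n$ and every $G\subset\Gamma$ of cardinality $n$ one has $\int xyz\,d\pi_{G'}\le\int xyz\,d\pi_G$ for every competitor $G'$ of $G$. *)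

theory Defs
  imports "HOL-Probability.Probability"
begin

text \<open>Points of \<open>\<real>\<^sup>3\<close> are triples \<open>(x, y, z)\<close>; the coordinate planes are copies of
  \<^typ>\<open>real \<times> real\<close>, with the coordinates kept in their original order.\<close>

type_synonym point3 = "real \<times> real \<times> real"

definition proj_xy :: "point3 \<Rightarrow> real \<times> real" where
  "proj_xy = (\<lambda>(x, y, z). (x, y))"

definition proj_xz :: "point3 \<Rightarrow> real \<times> real" where
  "proj_xz = (\<lambda>(x, y, z). (x, z))"

definition proj_yz :: "point3 \<Rightarrow> real \<times> real" where
  "proj_yz = (\<lambda>(x, y, z). (y, z))"

definition xyz :: "point3 \<Rightarrow> real" where
  "xyz = (\<lambda>(x, y, z). x * y * z)"

definition unit_square :: "(real \<times> real) set" where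
  "unit_square = {0..1} \<times> {0..1}"

definition unit_cube :: "point3 set" where
  "unit_cube = {0..1} \<times> {0..1} \<times> {0..1}"

definition borel_prob_measures :: "'a::topological_space set \<Rightarrow> 'a measure set" where
  "borel_prob_measures S = {M. prob_space M \<and> sets M = sets (restrict_space borel S)}"

text \<open>The arguments come in the order \<open>\<mu>\<^sub>1\<^sub>2, \<mu>\<^sub>2\<^sub>3, \<mu>\<^sub>1\<^sub>3\<close>.\<close>

definition plans ::
  "(real \<times> real) measure \<Rightarrow> (real \<times> real) measure \<Rightarrow> (real \<times> real) measure \<Rightarrow> point3 measure set"
  where
  "plans \<mu>12 \<mu>23 \<mu>13 = {\<pi> \<in> borel_prob_measures unit_cube.
     distr \<pi> (restrict_space borel unit_square) proj_xy = \<mu>12 \<and>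
     distr \<pi> (restrict_space borel unit_square) proj_yz = \<mu>23 \<and>
     distr \<pi> (restrict_space borel unit_square) proj_xz = \<mu>13}"

text \<open>The uniform measure on \<open>G\<close> is \<^const>\<open>pmf_of_set\<close>, which is meaningful only for finite
  non-empty sets; both are therefore required to be so. They need not have the same cardinality.\<close>

definition competitor :: "point3 set \<Rightarrow> point3 set \<Rightarrow> bool" where
  "competitor G G' \<longleftrightarrow>
     finite G \<and> G \<noteq> {} \<and> finite G' \<and> G' \<noteq> {} \<and>
     map_pmf proj_xy (pmf_of_set G') = map_pmf proj_xy (pmf_of_set G) \<and>
     map_pmf proj_yz (pmf_of_set G') = map_pmf proj_yz (pmf_of_set G) \<and>
     map_pmf proj_xz (pmf_of_set G') = map_pmf proj_xz (pmf_of_set G)"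

text \<open>Infinite sets, which have \<^const>\<open>card\<close> zero, and the empty set are excluded by
  \<^const>\<open>competitor\<close>.\<close>

definition cyclical_monotone :: "point3 set \<Rightarrow> bool" where
  "cyclical_monotone \<Gamma> \<longleftrightarrow>
     (\<forall>n::nat. \<forall>G. G \<subseteq> \<Gamma> \<and> card G = n \<longrightarrow>
        (\<forall>G'. competitor G G' \<longrightarrow>
           (\<integral>p. xyz p \<partial>measure_pmf (pmf_of_set G')) \<le> (\<integral>p. xyz p \<partial>measure_pmf (pmf_of_set G))))"

end

theory Submission
  imports Defs "HOL-Complex_Analysis.Great_Picard"
begin

text \<open>Suppose \<open>f\<^sub>k(x, y) + g\<^sub>k(y, z) + h\<^sub>k(x, z) \<ge> xyz\<close> on the cube and the
  \<open>\<pi>\<close>-integrals of the left-hand sides converge to the optimal value. Then, along a subsequence, the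
  left-hand sides converge to \<open>xyz\<close> on a set \<open>\<Gamma>\<close> of full \<open>\<pi>\<close>-measure. Since a competitor of
  \<open>G \<subseteq> \<Gamma>\<close> gives the left-hand sides the same integral as \<open>G\<close> does, \<open>\<Gamma>\<close> is cyclical monotone.

  Such dual functions exist because there is no duality gap. On the dyadic grid of mesh
  \<open>2\<^sup>-\<^sup>n\<close>, maximise the integral of \<open>xyz\<close> minus a large multiple of the squared deviation of the
  projections over all probability vectors. The first-order conditions at a maximiser \<open>w\<^sub>n\<close> yield a
  dual function whose value is at most the integral of \<open>xyz\<close> with respect to \<open>w\<^sub>n\<close>, up to the
  discretisation error. A limit of the \<open>w\<^sub>n\<close> has the prescribed projections, so these integrals
  are asymptotically at most the optimal value. The limit is built on binary digit sequences, where
  convergence of the masses of all cylinders suffices.\<close>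

section \<open>Approximate duality on a finite set\<close>

text \<open>A maximising sequence has coordinates in [0, 1] on \<open>I\<close>, so a subsequence
  converges at every index of \<open>I\<close>. Continuity is phrased through convergence on
  \<open>I\<close> alone, because values off \<open>I\<close> are arbitrary.\<close>

lemma simplex_attains_max:
  fixes L :: "('i \<Rightarrow> real) \<Rightarrow> real"
  assumes I: "finite I" and v: "\<forall>i\<in>I. 0 \<le> (v i :: real)" "sum v I = 1"
    and cont: "\<And>u l. (\<And>i. i \<in> I \<Longrightarrow> (\<lambda>n. u n i) \<longlonglongrightarrow> l i) \<Longrightarrow> (\<lambda>n. L (u n)) \<longlonglongrightarrow> L l"
    and bdd: "\<And>w. \<forall>i\<in>I. 0 \<le> w i \<Longrightarrow> sum w I = 1 \<Longrightarrow> L w \<le> b"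
  obtains w where "\<forall>i\<in>I. 0 \<le> w i" "sum w I = 1"
    "\<And>w'. \<forall>i\<in>I. 0 \<le> w' i \<Longrightarrow> sum w' I = 1 \<Longrightarrow> L w' \<le> L w"
proof -
  define S where "S = {w :: 'i \<Rightarrow> real. (\<forall>i\<in>I. 0 \<le> w i) \<and> sum w I = 1}"
  define s where "s = (SUP w\<in>S. L w)"
  have bdd': "bdd_above (L ` S)"
    using bdd by (auto simp: S_def intro!: bdd_aboveI2)
  have ne: "v \<in> S"
    using v by (auto simp: S_def)
  have "\<exists>w\<in>S. s - 1 / Suc n < L w" for n
    using less_cSUP_iff[OF _ bdd', of "s - 1 / Suc n"] ne by (auto simp: s_def)
  then obtain u where u: "\<And>n. u n \<in> S" "\<And>n. s - 1 / Suc n < L (u n)"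
    by metis
  have "norm (u n i) \<le> 1" if "i \<in> I" for n i
    using u(1)[of n] that member_le_sum[of i I "u n"] I by (auto simp: S_def)
  then obtain r :: "nat \<Rightarrow> nat" where r: "strict_mono r"
    and "\<And>i. i \<in> I \<Longrightarrow> \<exists>l. (\<lambda>n. u (r n) i) \<longlonglongrightarrow> l"
    using function_convergent_subsequence[OF countable_finite[OF I], of u 1] by blast
  then obtain w where w: "\<And>i. i \<in> I \<Longrightarrow> (\<lambda>n. u (r n) i) \<longlonglongrightarrow> w i"
    by metis
  have "0 \<le> w i" if "i \<in> I" for i
    using w[OF that] by (rule LIMSEQ_le_const) (use u(1) that in \<open>auto simp: S_def\<close>)
  moreover have "(\<lambda>n. sum (u (r n)) I) \<longlonglongrightarrow> sum w I"
    by (intro tendsto_sum w)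
  then have "sum w I = 1"
    using u(1) by (simp add: S_def LIMSEQ_const_iff)
  moreover have "L w' \<le> L w" if w': "\<forall>i\<in>I. 0 \<le> w' i" "sum w' I = 1" for w'
  proof -
    have "(\<lambda>n. s - 1 / Suc n) \<longlonglongrightarrow> s - 0"
      by (intro tendsto_diff tendsto_const LIMSEQ_Suc[OF lim_1_over_n])
    then have "(\<lambda>n. s - 1 / Suc (r n)) \<longlonglongrightarrow> s - 0"
      using LIMSEQ_subseq_LIMSEQ[OF _ r] by (auto simp: o_def)
    moreover have "(\<lambda>n. L (u (r n))) \<longlonglongrightarrow> L w"
      using w by (rule cont)
    ultimately have "s \<le> L w"
      using u(2) LIMSEQ_le[of "\<lambda>n. s - 1 / Suc (r n)" "s - 0" "\<lambda>n. L (u (r n))" "L w"]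
      by (auto intro: less_imp_le)
    moreover have "L w' \<le> s"
      unfolding s_def by (rule cSUP_upper[OF _ bdd']) (use w' in \<open>auto simp: S_def\<close>)
    ultimately show ?thesis by simp
  qed
  ultimately show thesis
    using that by blast
qed

text \<open>Linear programming duality up to \<open>\<epsilon>\<close>: the constraints are replaced by a quadratic penalty,
  and the multipliers \<open>f\<close> are the first-order conditions at a maximiser \<open>w\<close>.\<close>

lemma approx_duality:
  fixes a :: "'j \<Rightarrow> 'i \<Rightarrow> real"
  assumes I: "finite I" and J: "finite J" and v: "\<forall>i\<in>I. 0 \<le> v i" "sum v I = 1"
    and c: "\<And>i. i \<in> I \<Longrightarrow> 0 \<le> c i" "\<And>i. i \<in> I \<Longrightarrow> c i \<le> 1" and \<epsilon>: "\<epsilon> > 0"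
  obtains w f \<kappa> where "\<forall>i\<in>I. 0 \<le> w i" "sum w I = 1"
    "\<And>i. i \<in> I \<Longrightarrow> c i \<le> \<kappa> + (\<Sum>j\<in>J. f j * a j i)"
    "\<kappa> + (\<Sum>j\<in>J. f j * (\<Sum>i\<in>I. a j i * v i)) \<le> (\<Sum>i\<in>I. c i * w i)"
    "\<And>j. j \<in> J \<Longrightarrow> \<bar>(\<Sum>i\<in>I. a j i * w i) - (\<Sum>i\<in>I. a j i * v i)\<bar> \<le> \<epsilon>"
proof -
  define e where "e w j = (\<Sum>i\<in>I. a j i * w i) - (\<Sum>i\<in>I. a j i * v i)" for w j
  define C where "C w = (\<Sum>i\<in>I. c i * w i)" for w
  \<comment> \<open>With the factor 1/\<epsilon>^2, squared deviations of sum above \<epsilon>^2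
    cost more than 1, which is the most that the objective can gain, as it lies in [0, 1] on
    probability vectors.\<close>
  define L where "L w = C w - (\<Sum>j\<in>J. (e w j)\<^sup>2) / \<epsilon>\<^sup>2" for w
  have C: "C w \<le> 1" if "\<forall>i\<in>I. 0 \<le> w i" "sum w I = 1" for w
    using sum_mono[of I "\<lambda>i. c i * w i" w] that c by (auto simp: C_def mult_left_le_one_le)
  have "L w \<le> 1" if "\<forall>i\<in>I. 0 \<le> w i" "sum w I = 1" for w
  proof -
    have "0 \<le> (\<Sum>j\<in>J. (e w j)\<^sup>2) / \<epsilon>\<^sup>2"
      by (intro divide_nonneg_nonneg sum_nonneg) auto
    with C[OF that] show ?thesis by (simp add: L_def)
  qed
  moreover have "(\<lambda>n. L (u n)) \<longlonglongrightarrow> L l"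
    if "\<And>i. i \<in> I \<Longrightarrow> (\<lambda>n. u n i) \<longlonglongrightarrow> l i" for u l
    unfolding L_def C_def e_def using \<epsilon> by (intro tendsto_intros that) auto
  ultimately obtain w where w: "\<forall>i\<in>I. 0 \<le> w i" "sum w I = 1"
    and max: "\<And>w'. \<forall>i\<in>I. 0 \<le> w' i \<Longrightarrow> sum w' I = 1 \<Longrightarrow> L w' \<le> L w"
    using simplex_attains_max[OF I v, of L 1] by blast
  \<comment> \<open>\<open>f\<close> is the derivative of the penalty in the deviations. The
    constant \<open>\<kappa>\<close> gives the dual function the \<open>w\<close>-average
    \<open>C w\<close>, as complementary slackness demands.\<close>
  define f where "f j = 2 * e w j / \<epsilon>\<^sup>2" for j
  define \<kappa> where "\<kappa> = C w - (\<Sum>j\<in>J. f j * (\<Sum>i\<in>I. a j i * w i))"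
  have "c k \<le> \<kappa> + (\<Sum>j\<in>J. f j * a j k)" if k: "k \<in> I" for k
  proof -
    define d where "d j = a j k - (\<Sum>i\<in>I. a j i * w i)" for j
    define A where "A = c k - C w - (\<Sum>j\<in>J. f j * d j)"
    define Q where "Q = (\<Sum>j\<in>J. (d j)\<^sup>2) / \<epsilon>\<^sup>2"
    \<comment> \<open>On the segment from \<open>w\<close> towards the vertex \<open>k\<close>,
      \<open>L\<close> changes by t * A - t^2 * Q, which is not positive since \<open>w\<close> is a
      maximiser. Dividing by t and letting t tend to 0 leaves A <= 0, the dual inequality at
      \<open>k\<close>.\<close>
    have small: "A \<le> t * Q" if t: "0 < t" "t \<le> 1" for t
    proof -
      define w' where "w' i = w i + t * ((if i = k then 1 else 0) - w i)" for i
      have lin: "(\<Sum>i\<in>I. g i * w' i) = (\<Sum>i\<in>I. g i * w i) + t * (g k - (\<Sum>i\<in>I. g i * w i))" for g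
      proof -
        have "(\<Sum>i\<in>I. g i * w' i)
            = (\<Sum>i\<in>I. g i * w i + t * ((if i = k then g i else 0) - g i * w i))"
          by (intro sum.cong) (auto simp: w'_def algebra_simps)
        also have "\<dots> = (\<Sum>i\<in>I. g i * w i) + t * ((\<Sum>i\<in>I. if i = k then g i else 0) - (\<Sum>i\<in>I. g i * w i))"
          by (simp only: sum.distrib sum_distrib_left[symmetric] sum_subtractf)
        finally show ?thesis using I k by simp
      qed
      have "0 \<le> w' i" if "i \<in> I" for i
      proof -
        have "w' i = (1 - t) * w i + t * (if i = k then 1 else 0)"
          by (auto simp: w'_def algebra_simps)
        also have "\<dots> \<ge> 0"
          using t w that by (intro add_nonneg_nonneg mult_nonneg_nonneg) auto
        finally show ?thesis .
      qed
      moreover have "sum w' I = 1"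
        using lin[of "\<lambda>_. 1"] w by simp
      ultimately have "L w' \<le> L w"
        using max by blast
      moreover have "e w' j = e w j + t * d j" for j
        by (simp add: e_def lin d_def)
      then have "(\<Sum>j\<in>J. (e w' j)\<^sup>2)
          = (\<Sum>j\<in>J. (e w j)\<^sup>2 + t * (2 * e w j * d j) + t\<^sup>2 * (d j)\<^sup>2)"
        by (intro sum.cong) (auto simp: power2_eq_square algebra_simps)
      then have "(\<Sum>j\<in>J. (e w' j)\<^sup>2)
          = (\<Sum>j\<in>J. (e w j)\<^sup>2) + t * (\<Sum>j\<in>J. 2 * e w j * d j) + t\<^sup>2 * (\<Sum>j\<in>J. (d j)\<^sup>2)"
        by (simp only: sum.distrib sum_distrib_left[symmetric])
      moreover have "(\<Sum>j\<in>J. f j * d j) = (\<Sum>j\<in>J. 2 * e w j * d j) / \<epsilon>\<^sup>2"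
        by (simp add: f_def sum_divide_distrib)
      moreover have "C w' = C w + t * (c k - C w)"
        by (simp add: C_def lin)
      ultimately have "t * A \<le> t * (t * Q)"
        by (simp add: L_def A_def Q_def add_divide_distrib power2_eq_square algebra_simps)
      with t show ?thesis by simp
    qed
    have "(\<lambda>n. 1 / Suc n * Q) \<longlonglongrightarrow> 0 * Q"
      by (intro tendsto_mult tendsto_const LIMSEQ_Suc[OF lim_1_over_n])
    then have "A \<le> 0 * Q"
      by (rule LIMSEQ_le_const) (use small[of "1 / real (Suc _)"] in auto)
    then show ?thesis
      by (simp add: A_def \<kappa>_def d_def algebra_simps sum_subtractf)
  qed
  moreover have "\<kappa> + (\<Sum>j\<in>J. f j * (\<Sum>i\<in>I. a j i * v i)) \<le> C w"
  proof -
    \<comment> \<open>Every multiplier has the sign of its deviation, so averaging the dual function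
      over \<open>v\<close> instead of \<open>w\<close> can only lower its value.\<close>
    have "C w - \<kappa> - (\<Sum>j\<in>J. f j * (\<Sum>i\<in>I. a j i * v i)) = (\<Sum>j\<in>J. f j * e w j)"
      by (simp add: \<kappa>_def e_def algebra_simps sum_subtractf)
    also have "\<dots> \<ge> 0"
      by (intro sum_nonneg) (auto simp: f_def)
    finally show ?thesis by simp
  qed
  moreover have "\<bar>e w j\<bar> \<le> \<epsilon>" if "j \<in> J" for j
  proof -
    \<comment> \<open>Comparison with \<open>v\<close>, whose deviations vanish: the penalty at
      \<open>w\<close> is at most \<open>C w - C v\<close>, hence at most 1.\<close>
    have "0 \<le> C v"
      unfolding C_def using c v by (intro sum_nonneg) auto
    moreover have "L v = C v"
      by (simp add: L_def e_def)
    ultimately have "(\<Sum>j\<in>J. (e w j)\<^sup>2) / \<epsilon>\<^sup>2 \<le> 1"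
      using max[OF v] C[OF w] by (simp add: L_def[of w])
    then have "(\<Sum>j\<in>J. (e w j)\<^sup>2) \<le> \<epsilon>\<^sup>2"
      using \<epsilon> by (simp add: divide_le_eq)
    moreover have "(e w j)\<^sup>2 \<le> (\<Sum>j\<in>J. (e w j)\<^sup>2)"
      using J that by (intro member_le_sum) auto
    ultimately have "(e w j)\<^sup>2 \<le> \<epsilon>\<^sup>2" by simp
    then show ?thesis
      using \<epsilon> abs_le_square_iff[of "e w j" \<epsilon>] by simp
  qed
  ultimately show thesis
    using that[of w \<kappa> f] w by (simp add: e_def C_def)
qed

section \<open>Limits of measures on binary sequences\<close>

abbreviation unit_uniform :: "real measure" where
  "unit_uniform \<equiv> uniform_measure lborel {0..<1}"

lemma measurable_unit_uniform: "measurable unit_uniform N = measurable borel N"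
  by (rule measurable_cong_sets) simp_all

lemma prob_space_unit_uniform: "prob_space unit_uniform"
  by (rule prob_space_uniform_measure) auto

text \<open>Words list the digits with the most recent one first. The unit interval is divided so that the
  numbers with digits \<open>s\<close> form an interval of length \<open>w s\<close>, with left endpoint \<open>tree_left w s\<close>.\<close>

fun tree_left :: "(bool list \<Rightarrow> real) \<Rightarrow> bool list \<Rightarrow> real" where
  "tree_left w [] = 0"
| "tree_left w (d # s) = tree_left w s + (if d then w (False # s) else 0)"

fun tree_path :: "(bool list \<Rightarrow> real) \<Rightarrow> nat \<Rightarrow> real \<Rightarrow> bool list" where
  "tree_path w 0 u = []"
| "tree_path w (Suc n) u =
    (tree_left w (tree_path w n u) + w (False # tree_path w n u) \<le> u) # tree_path w n u"

text \<open>With half-open intervals, siblings partition their parent exactly, even if one of them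
  has length 0; the path of u thus picks the one word of each length whose interval contains
  u.\<close>

lemma tree_path_eq_iff:
  assumes "w [] = 1" "\<And>s. 0 \<le> w s" "\<And>s. w (False # s) + w (True # s) = w s" "0 \<le> u" "u < 1"
  shows "tree_path w (length s) u = s \<longleftrightarrow> tree_left w s \<le> u \<and> u < tree_left w s + w s"
proof (induction s)
  case Nil
  then show ?case using assms by simp
next
  case (Cons d s)
  show ?case
    using Cons assms(2)[of "False # s"] assms(2)[of "True # s"] assms(3)[of s]
    by (cases d) auto
qed

lemma tree_left_bounds:
  assumes "w [] = 1" "\<And>s. 0 \<le> w s" "\<And>s. w (False # s) + w (True # s) = w s"
  shows "0 \<le> tree_left w s" "tree_left w s + w s \<le> 1"
proof (induction s)
  case (Cons d s)
  {
    case 1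
    then show ?case using Cons assms(2)[of "False # s"] by auto
  next
    case 2
    then show ?case using Cons assms(2)[of "True # s"] assms(3)[of s] by (cases d) auto
  }
qed (use assms in auto)

abbreviation word :: "(nat \<Rightarrow> bool) \<Rightarrow> nat \<Rightarrow> bool list" where
  "word b n \<equiv> rev (map b [0..<n])"

text \<open>Any consistent system of cylinder masses is realised by random digits on the unit
  interval. This plays the part of an extension theorem for measures on sequence space.\<close>

lemma tree_process:
  assumes w: "w [] = 1" "\<And>s. 0 \<le> w s" "\<And>s. w (False # s) + w (True # s) = w s"
  obtains B :: "nat \<Rightarrow> real \<Rightarrow> bool"
  where "\<And>n. B n \<in> measurable borel (count_space UNIV)"
    "\<And>s. measure unit_uniform {u. word (\<lambda>k. B k u) (length s) = s} = w s"
proof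
  \<comment> \<open>The newest digit is the head of the path. Arguments outside [0, 1), a null set
    of \<open>unit_uniform\<close>, are sent to 0.\<close>
  define B where "B n u = hd (tree_path w (Suc n) (if u \<in> {0..<1} then u else 0))" for n u
  have word: "word (\<lambda>k. B k u) n = tree_path w n (if u \<in> {0..<1} then u else 0)" for n u
    by (induction n) (auto simp: B_def)
  have tree_path: "(\<lambda>u. tree_path w n (g u)) \<in> measurable borel (count_space UNIV)"
    if [measurable]: "g \<in> borel_measurable borel" for n and g :: "real \<Rightarrow> real"
  proof (induction n)
    case (Suc n)
    \<comment> \<open>The earlier path takes countably many values, so measurability may be checked
      with that path held fixed.\<close>
    have "(\<lambda>u. (tree_left w s + w (False # s) \<le> g u) # s) \<in> measurable borel (count_space UNIV)" for s
      by measurable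
    from measurable_compose_countable[OF this Suc] show ?case
      by simp
  qed simp
  show "B n \<in> measurable borel (count_space UNIV)" for n
    unfolding B_def by (rule measurable_compose[OF tree_path]) auto
  show "measure unit_uniform {u. word (\<lambda>k. B k u) (length s) = s} = w s" for s
  proof -
    have "{0..<1} \<inter> {u. word (\<lambda>k. B k u) (length s) = s} = {tree_left w s..<tree_left w s + w s}"
      using tree_path_eq_iff[OF w, of _ s] tree_left_bounds[OF w, of s] by (auto simp: word)
    moreover have "{u. word (\<lambda>k. B k u) (length s) = s} \<in> sets borel"
      using measurable_sets[OF tree_path[of "\<lambda>u. if u \<in> {0..<1} then u else 0" "length s"], of "{s}"]
      by (simp add: word vimage_def)
    ultimately show ?thesis
      using w(2)[of s] by (simp add: measure_uniform_measure)
  qed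
qed

definition prefix_determined :: "nat \<Rightarrow> ((nat \<Rightarrow> bool) \<Rightarrow> 'c) \<Rightarrow> bool" where
  "prefix_determined N F \<longleftrightarrow> (\<forall>b b'. (\<forall>k<N. b k = b' k) \<longrightarrow> F b = F b')"

text \<open>There are countably many cylinders and their masses lie in [0, 1], so along a
  subsequence all of them converge. The limits inherit total mass 1 and additivity, and
  \<open>tree_process\<close> turns them into random digits. A prefix-determined function is a
  finite combination of cylinder indicators, hence its integrals converge as well.\<close>

lemma cantor_compactness:
  fixes w :: "nat \<Rightarrow> 'i \<Rightarrow> real" and \<beta> :: "'i \<Rightarrow> nat \<Rightarrow> bool"
  assumes I: "\<And>k. finite (I k)" and w: "\<And>k i. i \<in> I k \<Longrightarrow> 0 \<le> w k i" "\<And>k. sum (w k) (I k) = 1"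
  obtains r B where "strict_mono r" "\<And>n. B n \<in> measurable borel (count_space UNIV)"
    "\<And>N (F :: _ \<Rightarrow> real). prefix_determined N F \<Longrightarrow> (\<lambda>u. F (\<lambda>n. B n u)) \<in> borel_measurable borel"
    "\<And>N F. prefix_determined N F \<Longrightarrow>
      (\<lambda>k. \<Sum>i\<in>I (r k). w (r k) i * F (\<beta> i)) \<longlonglongrightarrow> (\<integral>u. F (\<lambda>n. B n u) \<partial>unit_uniform)"
proof -
  define W where "W k s = (\<Sum>i\<in>I k. w k i * of_bool (word (\<beta> i) (length s) = s))" for k s
  have W_nonneg: "0 \<le> W k s" for k s
    unfolding W_def using w by (intro sum_nonneg) auto
  have "W k s \<le> sum (w k) (I k)" for k s
    unfolding W_def using w by (intro sum_mono) auto
  then have W_bounded: "norm (W k s) \<le> 1" for k s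
    using W_nonneg[of k s] w(2)[of k] by (metis abs_of_nonneg real_norm_def)
  have W_Nil: "W k [] = 1" for k
    using w by (simp add: W_def)
  have W_Cons: "W k (False # s) + W k (True # s) = W k s" for k s
    unfolding W_def sum.distrib[symmetric] by (intro sum.cong) auto
  obtain r :: "nat \<Rightarrow> nat" where r: "strict_mono r" and "\<And>s. \<exists>l. (\<lambda>k. W (r k) s) \<longlonglongrightarrow> l"
    using function_convergent_subsequence[of UNIV W 1, OF _ W_bounded] by auto
  then obtain V where V: "\<And>s. (\<lambda>k. W (r k) s) \<longlonglongrightarrow> V s"
    by metis
  have "V [] = 1"
    using V[of "[]"] by (simp add: W_Nil LIMSEQ_const_iff)
  moreover have "0 \<le> V s" for s
    using V[of s] by (rule LIMSEQ_le_const) (use W_nonneg in auto)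
  moreover have "V (False # s) + V (True # s) = V s" for s
    using tendsto_add[OF V[of "False # s"] V[of "True # s"]] V[of s]
    by (simp add: W_Cons LIMSEQ_unique)
  ultimately obtain B :: "nat \<Rightarrow> real \<Rightarrow> bool"
    where B: "\<And>n. B n \<in> measurable borel (count_space UNIV)"
      "\<And>s. measure unit_uniform {u. word (\<lambda>k. B k u) (length s) = s} = V s"
    using tree_process[of V] by blast
  note [measurable] = B(1)
  have conv: "(\<lambda>u. F (\<lambda>n. B n u)) \<in> borel_measurable borel \<and>
      (\<lambda>k. \<Sum>i\<in>I (r k). w (r k) i * F (\<beta> i)) \<longlonglongrightarrow> (\<integral>u. F (\<lambda>n. B n u) \<partial>unit_uniform)"
    if F: "prefix_determined N F" for N F
  proof -
    interpret prob_space unit_uniform by (rule prob_space_unit_uniform)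
    define S where "S = {s :: bool list. length s = N}"
    \<comment> \<open>\<open>word\<close> lists the newest digit first, so \<open>rev s\<close>
      restores the order of positions. Entries from \<open>N\<close> on are arbitrary and do not
      affect \<open>F\<close>.\<close>
    define g where "g s = F (\<lambda>k. rev s ! k)" for s
    have S: "finite S"
      using finite_lists_length_eq[of "UNIV :: bool set" N] by (simp add: S_def)
    have F_eq: "F b = (\<Sum>s\<in>S. g s * of_bool (word b N = s))" for b
    proof -
      have "(\<Sum>s\<in>S. g s * of_bool (word b N = s)) = (\<Sum>s\<in>S. if word b N = s then g s else 0)"
        by (intro sum.cong) auto
      also have "\<dots> = g (word b N)"
        using S by (subst sum.delta') (auto simp: S_def)
      also have "\<dots> = F b"
        using F unfolding g_def prefix_determined_def by simp
      finally show ?thesis ..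
    qed
    have word_meas: "{u. word (\<lambda>k. B k u) N = s} \<in> sets borel" for s
    proof -
      have "(\<lambda>u. word (\<lambda>k. B k u) N) \<in> measurable borel (count_space UNIV)"
      proof (induction N)
        case (Suc N)
        have "(\<lambda>u. B N u # s) \<in> measurable borel (count_space UNIV)" for s
          by measurable
        from measurable_compose_countable[OF this Suc] show ?case by simp
      qed simp
      from measurable_sets[OF this, of "{s}"] show ?thesis by (simp add: vimage_def)
    qed
    have ind: "of_bool (word (\<lambda>k. B k u) N = s) = (indicator {u. word (\<lambda>k. B k u) N = s} u :: real)" for u s
      by (simp add: indicator_def)
    have "(\<integral>u. F (\<lambda>n. B n u) \<partial>unit_uniform)
        = (\<integral>u. (\<Sum>s\<in>S. g s * indicator {u. word (\<lambda>k. B k u) N = s} u) \<partial>unit_uniform)"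
      by (subst F_eq) (simp only: ind)
    also have "\<dots> = (\<Sum>s\<in>S. g s * measure unit_uniform {u. word (\<lambda>k. B k u) N = s})"
      using word_meas by (subst Bochner_Integration.integral_sum)
        (auto intro!: integrable_mult_right integrable_real_indicator simp: emeasure_eq_measure)
    also have "\<dots> = (\<Sum>s\<in>S. g s * V s)"
      using B(2) by (intro sum.cong) (auto simp: S_def)
    finally have limit: "(\<integral>u. F (\<lambda>n. B n u) \<partial>unit_uniform) = (\<Sum>s\<in>S. g s * V s)" .
    have "(\<Sum>i\<in>I (r k). w (r k) i * F (\<beta> i)) = (\<Sum>s\<in>S. g s * W (r k) s)" for k
    proof -
      have "(\<Sum>i\<in>I (r k). w (r k) i * F (\<beta> i))
          = (\<Sum>i\<in>I (r k). \<Sum>s\<in>S. g s * (w (r k) i * of_bool (word (\<beta> i) N = s)))"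
        by (subst F_eq) (simp add: sum_distrib_left mult_ac)
      also have "\<dots> = (\<Sum>s\<in>S. \<Sum>i\<in>I (r k). g s * (w (r k) i * of_bool (word (\<beta> i) N = s)))"
        by (rule sum.swap)
      also have "\<dots> = (\<Sum>s\<in>S. g s * W (r k) s)"
        unfolding W_def sum_distrib_left by (intro sum.cong) (auto simp: S_def)
      finally show ?thesis .
    qed
    moreover have "(\<lambda>k. \<Sum>s\<in>S. g s * W (r k) s) \<longlonglongrightarrow> (\<Sum>s\<in>S. g s * V s)"
      by (intro tendsto_intros V)
    moreover have "(\<lambda>u. F (\<lambda>n. B n u)) \<in> borel_measurable borel"
      by (subst F_eq) (simp only: ind, use word_meas in measurable)
    ultimately show ?thesis
      by (simp add: limit)
  qed
  show thesis
  proof (rule that[of r B])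
    fix N and F :: "(nat \<Rightarrow> bool) \<Rightarrow> real"
    assume "prefix_determined N F"
    from conv[OF this] show "(\<lambda>u. F (\<lambda>n. B n u)) \<in> borel_measurable borel"
      "(\<lambda>k. \<Sum>i\<in>I (r k). w (r k) i * F (\<beta> i)) \<longlonglongrightarrow> (\<integral>u. F (\<lambda>n. B n u) \<partial>unit_uniform)"
      by simp_all
  qed (fact r B(1))+
qed

section \<open>Dyadic truncation\<close>

definition trunc :: "nat \<Rightarrow> real \<Rightarrow> real" where
  "trunc n x = \<lfloor>2 ^ n * x\<rfloor> / 2 ^ n"

text \<open>Position 0 holds the integer part of a number in [0, 2), so that the endpoint 1 of the
  unit interval has the expansion 1.000... and needs no separate treatment.\<close>

definition digit :: "nat \<Rightarrow> real \<Rightarrow> bool" where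
  "digit i x \<longleftrightarrow> odd \<lfloor>2 ^ i * x\<rfloor>"

lemma trunc_le: "trunc n x \<le> x"
proof -
  have "real_of_int \<lfloor>2 ^ n * x\<rfloor> \<le> 2 ^ n * x" by linarith
  then show ?thesis by (simp add: trunc_def divide_le_eq mult.commute)
qed

lemma trunc_gt: "x - 1 / 2 ^ n < trunc n x"
proof -
  have "x - 1 / 2 ^ n = (2 ^ n * x - 1) / 2 ^ n"
    by (simp add: diff_divide_distrib)
  also have "\<dots> < trunc n x"
    unfolding trunc_def by (intro divide_strict_right_mono) (linarith, simp)
  finally show ?thesis .
qed

lemma trunc_nonneg: "0 \<le> x \<Longrightarrow> 0 \<le> trunc n x"
  by (simp add: trunc_def)

lemma floor_power_div: "m \<le> n \<Longrightarrow> \<lfloor>2 ^ n * x\<rfloor> div 2 ^ (n - m) = \<lfloor>2 ^ m * (x :: real)\<rfloor>"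
proof -
  assume "m \<le> n"
  then have "2 ^ n = (2 ^ m * 2 ^ (n - m) :: real)"
    by (simp flip: power_add)
  then have "2 ^ n * x / real_of_int (2 ^ (n - m)) = 2 ^ m * x"
    by simp
  then show ?thesis
    using floor_divide_real_eq_div[of "2 ^ (n - m)" "2 ^ n * x"] by simp
qed

lemma trunc_trunc: "m \<le> n \<Longrightarrow> trunc m (trunc n x) = trunc m x"
proof -
  assume "m \<le> n"
  then have "2 ^ n = (2 ^ m * 2 ^ (n - m) :: real)"
    by (simp flip: power_add)
  then have "2 ^ m * trunc n x = real_of_int \<lfloor>2 ^ n * x\<rfloor> / real_of_int (2 ^ (n - m))"
    by (simp add: trunc_def)
  then have "\<lfloor>2 ^ m * trunc n x\<rfloor> = \<lfloor>2 ^ n * x\<rfloor> div 2 ^ (n - m)"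
    by (simp only: floor_divide_of_int_eq)
  then show ?thesis
    using floor_power_div[OF \<open>m \<le> n\<close>, of x] by (simp add: trunc_def)
qed

lemma trunc_mono: "m \<le> n \<Longrightarrow> trunc m x \<le> trunc n x"
  using trunc_le[of m "trunc n x"] by (simp add: trunc_trunc)

lemma sum_digits:
  assumes "0 \<le> x" "x < 2"
  shows "(\<Sum>i\<le>n. of_bool (digit i x) / 2 ^ i) = trunc n x"
proof (induction n)
  case 0
  have "\<lfloor>x\<rfloor> = 0 \<or> \<lfloor>x\<rfloor> = 1" using assms by linarith
  then show ?case by (auto simp: trunc_def digit_def)
next
  case (Suc n)
  define k where "k = \<lfloor>2 ^ Suc n * x\<rfloor>"
  have "\<lfloor>2 ^ n * x\<rfloor> = k div 2"
    using floor_power_div[of n "Suc n" x] by (simp add: k_def)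
  moreover have "k = 2 * (k div 2) + of_bool (odd k)"
    by (cases "odd k") simp_all
  then have "real_of_int k = 2 * real_of_int (k div 2) + of_bool (odd k)"
    by (metis of_int_add of_int_mult of_int_numeral of_int_of_bool)
  ultimately have "trunc (Suc n) x = trunc n x + of_bool (odd k) / 2 ^ Suc n"
    unfolding trunc_def k_def[symmetric] by (simp add: add_divide_distrib)
  then show ?case
    using Suc by (simp only: sum.atMost_Suc digit_def[of "Suc n"] k_def[symmetric])
qed

text \<open>Truncations approach x from below. A closed condition on x therefore becomes a countable
  intersection of conditions on finitely many digits, which is how the marginals are identified
  later.\<close>

lemma trunc_le_iff: "(\<forall>m. trunc m x \<le> a) \<longleftrightarrow> x \<le> a"
proof
  assume *: "\<forall>m. trunc m x \<le> a"
  have "(\<lambda>m. 1 / 2 ^ m :: real) \<longlonglongrightarrow> 0"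
    using LIMSEQ_realpow_zero[of "1/2 :: real"] by (simp add: power_one_over)
  then have "(\<lambda>m. a + 1 / 2 ^ m) \<longlonglongrightarrow> a + 0"
    by (intro tendsto_add tendsto_const)
  moreover have "x \<le> a + 1 / 2 ^ m" for m
    using *[rule_format, of m] trunc_gt[of x m] by simp
  ultimately have "x \<le> a + 0"
    by (intro LIMSEQ_le_const) auto
  then show "x \<le> a" by simp
qed (use trunc_le order_trans in blast)

lemma borel_measurable_trunc [measurable]: "trunc n \<in> borel_measurable borel"
  unfolding trunc_def by measurable

lemma finite_trunc_unit: "finite (trunc n ` {0..1})"
proof (rule finite_subset)
  show "trunc n ` {0..1} \<subseteq> (\<lambda>k. real_of_int k / 2 ^ n) ` {0..2 ^ n}"
  proof (clarsimp simp: trunc_def)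
    fix x :: real assume "0 \<le> x" "x \<le> 1"
    then have "0 \<le> \<lfloor>2 ^ n * x\<rfloor>" "\<lfloor>2 ^ n * x\<rfloor> \<le> 2 ^ n"
      by (simp_all add: floor_le_iff add.commute le_less_trans[of _ "2 ^ n"])
    then show "real_of_int \<lfloor>2 ^ n * x\<rfloor> / 2 ^ n \<in> (\<lambda>k. real_of_int k / 2 ^ n) ` {0..2 ^ n}"
      by auto
  qed
qed simp

section \<open>Discretising the cube\<close>

text \<open>Coordinates and coordinate planes are indexed by numbers so that one argument serves all
  three projections. Every index above 1 means z.\<close>

fun coord :: "nat \<Rightarrow> point3 \<Rightarrow> real" where
  "coord j (x, y, z) = (if j = 0 then x else if j = 1 then y else z)"

definition axes :: "(nat \<times> nat) set" where
  "axes = {(0, 1), (1, 2), (0, 2)}"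

definition pair_proj :: "nat \<times> nat \<Rightarrow> point3 \<Rightarrow> real \<times> real" where
  "pair_proj a p = (coord (fst a) p, coord (snd a) p)"

lemma pair_proj_simps:
  "pair_proj (0, 1) = proj_xy" "pair_proj (1, 2) = proj_yz" "pair_proj (0, 2) = proj_xz"
  by (auto simp: pair_proj_def proj_xy_def proj_yz_def proj_xz_def)

lemma finite_axes [simp]: "finite axes"
  by (simp add: axes_def)

lemma sum_axes: "(\<Sum>a\<in>axes. F a) = F (0, 1) + F (1, 2) + F (0, 2)" for F :: "_ \<Rightarrow> real"
  by (simp add: axes_def)

lemma borel_measurable_coord [measurable]: "coord j \<in> borel_measurable borel"
proof -
  have "coord j = (\<lambda>p. if j = 0 then fst p else if j = 1 then fst (snd p) else snd (snd p))"
    by auto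
  also have "\<dots> \<in> borel_measurable borel"
    by (cases "j = 0"; cases "j = 1") (auto intro!: borel_measurable_continuous_onI continuous_intros)
  finally show ?thesis .
qed

lemma borel_measurable_pair_proj [measurable]: "pair_proj a \<in> borel_measurable borel"
  unfolding pair_proj_def by measurable

lemma borel_measurable_xyz [measurable]: "xyz \<in> borel_measurable borel"
proof -
  have "xyz = (\<lambda>p. coord 0 p * coord 1 p * coord 2 p)"
    by (auto simp: xyz_def)
  also have "\<dots> \<in> borel_measurable borel"
    by measurable
  finally show ?thesis .
qed

lemma coord_unit_cube: "p \<in> unit_cube \<Longrightarrow> coord j p \<in> {0..1}"
  by (cases p) (auto simp: unit_cube_def)

lemma pair_proj_unit_cube: "p \<in> unit_cube \<Longrightarrow> pair_proj a p \<in> unit_square"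
  using coord_unit_cube[of p] by (auto simp: pair_proj_def unit_square_def)

lemma xyz_unit_cube: "p \<in> unit_cube \<Longrightarrow> xyz p \<in> {0..1}"
  by (auto simp: unit_cube_def xyz_def mult_le_one)

definition trunc2 :: "nat \<Rightarrow> real \<times> real \<Rightarrow> real \<times> real" where
  "trunc2 n = map_prod (trunc n) (trunc n)"

definition trunc3 :: "nat \<Rightarrow> point3 \<Rightarrow> point3" where
  "trunc3 n = map_prod (trunc n) (map_prod (trunc n) (trunc n))"

lemma coord_trunc3: "coord j (trunc3 n p) = trunc n (coord j p)"
  by (cases p) (auto simp: trunc3_def)

lemma pair_proj_trunc3: "pair_proj a (trunc3 n p) = trunc2 n (pair_proj a p)"
  by (simp add: pair_proj_def coord_trunc3 trunc2_def)

lemma trunc2_trunc2: "m \<le> n \<Longrightarrow> trunc2 m (trunc2 n s) = trunc2 m s"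
  by (cases s) (simp add: trunc2_def trunc_trunc)

lemma trunc3_unit_cube: "p \<in> unit_cube \<Longrightarrow> trunc3 n p \<in> unit_cube"
  by (auto simp: trunc3_def unit_cube_def trunc_nonneg intro: order_trans[OF trunc_le])

lemma finite_trunc3_unit_cube: "finite (trunc3 n ` unit_cube)"
  by (rule finite_subset[OF _ finite_cartesian_product[OF finite_trunc_unit[of n]
        finite_cartesian_product[OF finite_trunc_unit[of n] finite_trunc_unit[of n]]]])
    (auto simp: trunc3_def unit_cube_def)

lemma finite_trunc2_unit_square: "finite (trunc2 n ` unit_square)"
  by (rule finite_subset[OF _ finite_cartesian_product[OF finite_trunc_unit[of n] finite_trunc_unit[of n]]])
    (auto simp: trunc2_def unit_square_def)

lemma borel_measurable_trunc3 [measurable]: "trunc3 n \<in> borel_measurable borel"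
proof -
  have "trunc3 n = (\<lambda>p. (trunc n (coord 0 p), trunc n (coord 1 p), trunc n (coord 2 p)))"
    by (auto simp: trunc3_def)
  also have "\<dots> \<in> borel_measurable borel"
    by (intro borel_measurable_Pair measurable_compose[OF _ borel_measurable_trunc] borel_measurable_coord)
  finally show ?thesis .
qed

lemma xyz_trunc3:
  assumes "p \<in> unit_cube"
  shows "xyz (trunc3 n p) \<le> xyz p" "xyz p \<le> xyz (trunc3 n p) + 3 / 2 ^ n"
proof -
  obtain x y z where p: "p = (x, y, z)" and "x \<in> {0..1}" "y \<in> {0..1}" "z \<in> {0..1}"
    using assms by (auto simp: unit_cube_def)
  define x' y' z' where "x' = trunc n x" "y' = trunc n y" "z' = trunc n z"
  have *: "0 \<le> t" "t \<le> 1" "0 \<le> trunc n t" "trunc n t \<le> 1" "0 \<le> t - trunc n t" "t - trunc n t \<le> 1 / 2 ^ n"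
    if "t \<in> {0..1}" for t
    using that trunc_le[of n t] trunc_gt[of t n] trunc_nonneg[of t n] by auto
  note bounds = *[OF \<open>x \<in> {0..1}\<close>, folded x'_y'_z'_def] *[OF \<open>y \<in> {0..1}\<close>, folded x'_y'_z'_def]
    *[OF \<open>z \<in> {0..1}\<close>, folded x'_y'_z'_def]
  \<comment> \<open>Telescoping: one coordinate is truncated at a time. The remaining factors lie in
    [0, 1], so each of the three terms is between 0 and 1/2^n.\<close>
  have eq: "xyz p - xyz (trunc3 n p) = (x - x') * (y * z) + (y - y') * (x' * z) + (z - z') * (x' * y')"
    by (simp add: p xyz_def trunc3_def x'_y'_z'_def algebra_simps)
  show "xyz (trunc3 n p) \<le> xyz p"
  proof -
    have "0 \<le> xyz p - xyz (trunc3 n p)"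
      unfolding eq using bounds by (intro add_nonneg_nonneg mult_nonneg_nonneg) auto
    then show ?thesis by simp
  qed
  have "xyz p - xyz (trunc3 n p) \<le> (x - x') + (y - y') + (z - z')"
    unfolding eq using bounds by (intro add_mono mult_right_le_one_le mult_le_one mult_nonneg_nonneg) auto
  with bounds show "xyz p \<le> xyz (trunc3 n p) + 3 / 2 ^ n"
    by simp
qed

section \<open>Nearly optimal dual functions for a measure on the cube\<close>

locale cube_measure = prob_space \<pi> for \<pi> :: "point3 measure" +
  assumes sets_eq: "sets \<pi> = sets (restrict_space borel unit_cube)"
begin

lemma space_eq: "space \<pi> = unit_cube"
  using sets_eq_imp_space_eq[OF sets_eq] by (simp add: space_restrict_space)

lemma measurable_borel [measurable (raw)]: "f \<in> measurable borel N \<Longrightarrow> f \<in> measurable \<pi> N"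
  using measurable_restrict_space1[of f borel N unit_cube] measurable_cong_sets[OF sets_eq refl] by blast

lemma integrable_trunc3: "integrable \<pi> (\<lambda>p. h (trunc3 n p) :: real)"
  and integral_trunc3: "(\<integral>p. h (trunc3 n p) \<partial>\<pi>)
    = (\<Sum>i\<in>trunc3 n ` unit_cube. h i * measure \<pi> {p \<in> space \<pi>. trunc3 n p = i})"
proof -
  let ?I = "trunc3 n ` unit_cube" and ?A = "\<lambda>i. {p \<in> space \<pi>. trunc3 n p = i}"
  have A: "?A i \<in> sets \<pi>" for i
    by measurable
  have eq: "h (trunc3 n p) = (\<Sum>i\<in>?I. h i * indicator (?A i) p)" if "p \<in> space \<pi>" for p
  proof -
    have "(\<Sum>i\<in>?I. h i * indicator (?A i) p) = (\<Sum>i\<in>?I. if trunc3 n p = i then h i else 0)"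
      using that by (intro sum.cong) (auto simp: indicator_def)
    then show ?thesis
      using that finite_trunc3_unit_cube[of n] by (subst (asm) sum.delta') (auto simp: space_eq)
  qed
  have int: "integrable \<pi> (\<lambda>p. h i * indicator (?A i) p)" for i
    using A by (intro integrable_mult_right integrable_real_indicator) (auto simp: emeasure_eq_measure)
  show "integrable \<pi> (\<lambda>p. h (trunc3 n p))"
    using int by (subst Bochner_Integration.integrable_cong[OF refl eq]) auto
  have "(\<integral>p. h (trunc3 n p) \<partial>\<pi>) = (\<integral>p. (\<Sum>i\<in>?I. h i * indicator (?A i) p) \<partial>\<pi>)"
    by (intro Bochner_Integration.integral_cong refl eq)
  also have "\<dots> = (\<Sum>i\<in>?I. h i * measure \<pi> (?A i))"
    using int A by (subst Bochner_Integration.integral_sum) auto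
  finally show "(\<integral>p. h (trunc3 n p) \<partial>\<pi>) = (\<Sum>i\<in>?I. h i * measure \<pi> (?A i))" .
qed

lemma integrable_xyz: "integrable \<pi> xyz"
  by (rule integrable_const_bound[of _ 1]) (use xyz_unit_cube in \<open>force simp: space_eq\<close>)+

text \<open>Level n of the duality: a primal candidate \<open>w\<close> paired with a dual function
  \<open>f\<close> whose value exceeds that of \<open>w\<close> by no more than the discretisation
  error. Testing the marginals of \<open>w\<close> against all q bounded by 1 makes them close to
  the discretised marginals of \<pi> in total variation. Only the \<pi>-side is truncated, because
  the \<open>I\<close> that is constructed lies on the grid.\<close>

definition approx_optimal ::
  "nat \<Rightarrow> point3 set \<Rightarrow> (point3 \<Rightarrow> real) \<Rightarrow> (nat \<times> nat \<Rightarrow> real \<times> real \<Rightarrow> real) \<Rightarrow> bool"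
where
  "approx_optimal n I w f \<longleftrightarrow> finite I \<and> I \<subseteq> unit_cube \<and> (\<forall>p\<in>I. 0 \<le> w p) \<and> sum w I = 1
    \<and> (\<forall>a\<in>axes. integrable \<pi> (\<lambda>p. f a (pair_proj a p)))
    \<and> (\<forall>p\<in>unit_cube. xyz p \<le> (\<Sum>a\<in>axes. f a (pair_proj a p)))
    \<and> (\<integral>p. (\<Sum>a\<in>axes. f a (pair_proj a p)) \<partial>\<pi>) \<le> (\<Sum>p\<in>I. w p * xyz p) + 3 / 2 ^ n
    \<and> (\<forall>a\<in>axes. \<forall>q. (\<forall>s. \<bar>q s\<bar> \<le> 1) \<longrightarrow>
      \<bar>(\<Sum>p\<in>I. w p * q (pair_proj a p)) - (\<integral>p. q (trunc2 n (pair_proj a p)) \<partial>\<pi>)\<bar> \<le> 1 / 2 ^ n)"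

text \<open>\<open>approx_duality\<close> is applied on the grid, with the discretisation of \<pi>
  as the reference vector and one constraint for each cell of each of the three projections.\<close>

lemma approx_optimal_exists: "\<exists>I w f. approx_optimal n I w f"
proof -
  define I where "I = trunc3 n ` unit_cube"
  define S where "S = trunc2 n ` unit_square"
  define v where "v i = measure \<pi> {p \<in> space \<pi>. trunc3 n p = i}" for i
  \<comment> \<open>Errors of up to \<open>card S\<close> cells add up, and the total must stay
    within 1/2^n.\<close>
  define \<epsilon> where "\<epsilon> = 1 / (2 ^ n * real (card S))"
  have finI: "finite I" and finS: "finite S"
    by (simp_all add: I_def S_def finite_trunc3_unit_cube finite_trunc2_unit_square)
  have "(0, 0) \<in> unit_square"
    by (simp add: unit_square_def)
  then have card_S: "0 < card S"
    using finS by (auto simp: S_def card_gt_0_iff)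
  have I_cube: "I \<subseteq> unit_cube"
    using trunc3_unit_cube by (auto simp: I_def)
  have I_S: "pair_proj a i \<in> S" if "i \<in> I" for a i
    using that pair_proj_unit_cube[of _ a] by (auto simp: I_def S_def pair_proj_trunc3 intro!: imageI)
  have v: "(\<Sum>i\<in>I. h i * v i) = (\<integral>p. h (trunc3 n p) \<partial>\<pi>)" for h
    by (simp add: integral_trunc3 I_def v_def)
  \<comment> \<open>The row \<open>(a, s)\<close> is the indicator of a fibre, so pairing it with
    weights gives the mass that their projection along \<open>a\<close> puts at
    \<open>s\<close>.\<close>
  define M where "M = (\<lambda>(a, s) i. of_bool (pair_proj a i = s) :: real)"
  have finJ: "finite (axes \<times> S)"
    using finS by simp
  have v_nonneg: "\<forall>i\<in>I. 0 \<le> v i"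
    by (simp add: v_def)
  have sum_v: "sum v I = 1"
    using v[of "\<lambda>_. 1"] prob_space by simp
  have xyz_I: "0 \<le> xyz i" "xyz i \<le> 1" if "i \<in> I" for i
    using xyz_unit_cube[of i] that I_cube by auto
  have \<epsilon>: "0 < \<epsilon>"
    using card_S by (simp add: \<epsilon>_def)
  obtain w F \<kappa> where w: "\<forall>i\<in>I. 0 \<le> w i" "sum w I = 1"
    and dual: "\<And>i. i \<in> I \<Longrightarrow> xyz i \<le> \<kappa> + (\<Sum>j\<in>axes \<times> S. F j * M j i)"
      "\<kappa> + (\<Sum>j\<in>axes \<times> S. F j * (\<Sum>i\<in>I. M j i * v i)) \<le> (\<Sum>i\<in>I. xyz i * w i)"
    and err: "\<And>j. j \<in> axes \<times> S \<Longrightarrow> \<bar>(\<Sum>i\<in>I. M j i * w i) - (\<Sum>i\<in>I. M j i * v i)\<bar> \<le> \<epsilon>"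
    by (rule approx_duality[where c = xyz and a = M, OF finI finJ v_nonneg sum_v _ _ \<epsilon>])
      ((rule xyz_I | rule that); assumption)+
  have sum_S: "(\<Sum>s\<in>S. G s * M (a, s) i) = G (pair_proj a i)" if "i \<in> I" for G :: "_ \<Rightarrow> real" and a i
  proof -
    have "(\<Sum>s\<in>S. G s * M (a, s) i) = (\<Sum>s\<in>S. if pair_proj a i = s then G s else 0)"
      by (intro sum.cong) (auto simp: M_def)
    then show ?thesis
      using finS I_S[OF that] by simp
  qed
  \<comment> \<open>The multipliers are extended from the grid to the square by truncation. The
    constant \<open>\<kappa>\<close> and the loss 3/2^n from truncating xyz go into a single
    component, so that they are counted once.\<close>
  define f where "f a s = F (a, trunc2 n s) + (if a = (0, 1) then \<kappa> + 3 / 2 ^ n else 0)" for a s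
  define H where "H i = (\<Sum>a\<in>axes. F (a, pair_proj a i))" for i
  have H: "H i = (\<Sum>j\<in>axes \<times> S. F j * M j i)" if "i \<in> I" for i
    unfolding H_def sum.cartesian_product[symmetric, of _ S, simplified]
    using that by (subst sum.cartesian_product') (simp add: sum_S)
  have f_sum: "(\<Sum>a\<in>axes. f a (pair_proj a p)) = \<kappa> + H (trunc3 n p) + 3 / 2 ^ n" for p
    by (simp add: f_def H_def sum_axes pair_proj_trunc3)
  have "integrable \<pi> (\<lambda>p. f a (pair_proj a p))" for a
  proof -
    have "integrable \<pi> (\<lambda>p. F (a, pair_proj a (trunc3 n p)))"
      by (rule integrable_trunc3)
    then show ?thesis
      by (simp add: f_def pair_proj_trunc3)
  qed
  moreover have "xyz p \<le> (\<Sum>a\<in>axes. f a (pair_proj a p))" if "p \<in> unit_cube" for p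
    using xyz_trunc3(2)[OF that, of n] dual(1)[of "trunc3 n p"] H[of "trunc3 n p"] that
    by (simp add: f_sum I_def)
  moreover have "(\<integral>p. (\<Sum>a\<in>axes. f a (pair_proj a p)) \<partial>\<pi>) \<le> (\<Sum>p\<in>I. w p * xyz p) + 3 / 2 ^ n"
  proof -
    have "(\<integral>p. (\<Sum>a\<in>axes. f a (pair_proj a p)) \<partial>\<pi>) = \<kappa> + (\<integral>p. H (trunc3 n p) \<partial>\<pi>) + 3 / 2 ^ n"
      unfolding f_sum using integrable_trunc3[of H n] prob_space by simp
    also have "(\<integral>p. H (trunc3 n p) \<partial>\<pi>) = (\<Sum>i\<in>I. \<Sum>j\<in>axes \<times> S. F j * (M j i * v i))"
      unfolding v[symmetric] using H by (intro sum.cong) (auto simp: sum_distrib_right mult.assoc)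
    also have "\<dots> = (\<Sum>j\<in>axes \<times> S. F j * (\<Sum>i\<in>I. M j i * v i))"
      by (subst sum.swap) (simp add: sum_distrib_left)
    finally show ?thesis
      using dual(2) by (simp add: mult.commute)
  qed
  moreover have "\<bar>(\<Sum>p\<in>I. w p * q (pair_proj a p)) - (\<integral>p. q (trunc2 n (pair_proj a p)) \<partial>\<pi>)\<bar> \<le> 1 / 2 ^ n"
    if a: "a \<in> axes" and q: "\<And>s. \<bar>q s\<bar> \<le> 1" for a and q :: "_ \<Rightarrow> real"
  proof -
    \<comment> \<open>Grouping the grid points by the value of their projection reduces any test
      function q to the cell constraints.\<close>
    have split: "(\<Sum>p\<in>I. q (pair_proj a p) * u p) = (\<Sum>s\<in>S. q s * (\<Sum>i\<in>I. M (a, s) i * u i))" for u :: "_ \<Rightarrow> real"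
    proof -
      have "(\<Sum>p\<in>I. q (pair_proj a p) * u p) = (\<Sum>p\<in>I. (\<Sum>s\<in>S. q s * M (a, s) p) * u p)"
        by (intro sum.cong) (auto simp: sum_S)
      also have "\<dots> = (\<Sum>p\<in>I. \<Sum>s\<in>S. q s * (M (a, s) p * u p))"
        by (simp add: sum_distrib_right mult.assoc)
      finally show ?thesis
        by (subst (asm) sum.swap) (simp add: sum_distrib_left)
    qed
    have "(\<integral>p. q (trunc2 n (pair_proj a p)) \<partial>\<pi>) = (\<Sum>p\<in>I. q (pair_proj a p) * v p)"
      by (simp add: v pair_proj_trunc3)
    then have "(\<Sum>p\<in>I. w p * q (pair_proj a p)) - (\<integral>p. q (trunc2 n (pair_proj a p)) \<partial>\<pi>)
        = (\<Sum>s\<in>S. q s * ((\<Sum>i\<in>I. M (a, s) i * w i) - (\<Sum>i\<in>I. M (a, s) i * v i)))"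
      using split[of w] split[of v] by (simp add: mult.commute[of "w _"] sum_subtractf right_diff_distrib)
    also have "\<bar>\<dots>\<bar> \<le> (\<Sum>s\<in>S. \<epsilon>)"
    proof (rule order_trans[OF sum_abs sum_mono])
      fix s assume "s \<in> S"
      then have "\<bar>(\<Sum>i\<in>I. M (a, s) i * w i) - (\<Sum>i\<in>I. M (a, s) i * v i)\<bar> \<le> \<epsilon>"
        using err a by auto
      with q[of s] show "\<bar>q s * ((\<Sum>i\<in>I. M (a, s) i * w i) - (\<Sum>i\<in>I. M (a, s) i * v i))\<bar> \<le> \<epsilon>"
        unfolding abs_mult by (meson abs_ge_zero mult_left_le_one_le order_trans)
    qed
    also have "\<dots> = 1 / 2 ^ n"
      using card_S by (simp add: \<epsilon>_def)
    finally show ?thesis .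
  qed
  ultimately have "approx_optimal n I w f"
    unfolding approx_optimal_def using finI I_cube w by blast
  then show ?thesis
    by blast
qed

end

section \<open>Limit plans\<close>

lemma measure_eq_on_quadrants:
  fixes M N :: "(real \<times> real) measure"
  assumes "prob_space M" "prob_space N" "sets M = sets borel" "sets N = sets borel"
    and eq: "\<And>a b. measure M ({..a} \<times> {..b}) = measure N ({..a} \<times> {..b})"
  shows "M = N"
proof -
  interpret M: prob_space M by fact
  interpret N: prob_space N by fact
  have quadrant: "{..s} = {..fst s} \<times> {..snd s}" for s :: "real \<times> real"
    by (auto simp: less_eq_prod_def)
  let ?E = "range (\<lambda>s :: real \<times> real. {..s})"
  show ?thesis
  proof (rule measure_eqI_generator_eq[of ?E UNIV M N "\<lambda>n. {..(real n, real n)}"])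
    show "Int_stable ?E"
    proof (rule Int_stableI_image)
      fix s t :: "real \<times> real"
      show "\<exists>u\<in>UNIV. {..s} \<inter> {..t} = {..u}"
        by (intro bexI[of _ "(min (fst s) (fst t), min (snd s) (snd t))"]) (auto simp: quadrant)
    qed
    show "emeasure M X = emeasure N X" if "X \<in> ?E" for X
      using that eq by (auto simp: M.emeasure_eq_measure N.emeasure_eq_measure quadrant)
    show "sets M = sigma_sets UNIV ?E" "sets N = sigma_sets UNIV ?E"
      using assms(3,4) by (simp_all add: borel_eq_atMost)
    show "(\<Union>n. {..(real n, real n)}) = UNIV"
    proof (safe, goal_cases)
      case (2 x y)
      obtain n where "max x y \<le> real n"
        using real_arch_simple by blast
      then show ?case by (auto simp: quadrant)
    qed simp
  qed auto
qed

text \<open>Quadrants compare measures on the whole plane, whereas \<open>plans\<close> uses the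
  trace on the square; this passes from the former to the latter.\<close>

lemma distr_restrict_space_eqI:
  assumes "S \<in> sets borel" "f \<in> measurable M (restrict_space borel S)"
    "g \<in> measurable N (restrict_space borel S)" "distr M borel f = distr N borel g"
  shows "distr M (restrict_space borel S) f = distr N (restrict_space borel S) g"
proof (rule measure_eqI)
  fix A assume "A \<in> sets (distr M (restrict_space borel S) f)"
  then have A: "A \<in> sets (restrict_space borel S)" "A \<in> sets borel"
    using assms(1) by (auto simp: sets_restrict_space)
  moreover have "f \<in> borel_measurable M" "g \<in> borel_measurable N"
    using assms by (auto simp: measurable_restrict_space2_iff)
  ultimately show "emeasure (distr M (restrict_space borel S) f) A
      = emeasure (distr N (restrict_space borel S) g) A"
    using assms(2,3) arg_cong[OF assms(4), of "\<lambda>D. emeasure D A"]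
    by (simp add: emeasure_distr del: vimage_eq)
qed simp

lemma unit_square_borel: "unit_square \<in> sets borel"
  unfolding unit_square_def by (intro borel_closed closed_Times closed_atLeastAtMost)

text \<open>A limit of measures on digit sequences may charge sequences that represent no number in
  \<open>[0, 1]\<close>, hence the clipping in \<open>decode\<close>; it only matters on a null set.\<close>

definition digits3 :: "point3 \<Rightarrow> nat \<Rightarrow> bool" where
  "digits3 p k = digit (k div 3) (coord (k mod 3) p)"

definition decode :: "nat \<Rightarrow> nat \<Rightarrow> (nat \<Rightarrow> bool) \<Rightarrow> real" where
  "decode j m b = min 1 (\<Sum>i\<le>m. of_bool (b (3 * i + j)) / 2 ^ i)"

lemma decode_digits3:
  assumes "p \<in> unit_cube" "j < 3"
  shows "decode j m (digits3 p) = trunc m (coord j p)"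
proof -
  have "coord j p \<in> {0..1}"
    using coord_unit_cube[OF assms(1)] .
  then have "trunc m (coord j p) \<le> 1"
    using trunc_le[of m "coord j p"] by auto
  moreover have "digits3 p (3 * i + j) = digit i (coord j p)" for i
    using assms(2) by (simp add: digits3_def)
  then have "(\<Sum>i\<le>m. of_bool (digits3 p (3 * i + j)) / 2 ^ i) = trunc m (coord j p)"
    using sum_digits[of "coord j p" m] \<open>coord j p \<in> {0..1}\<close> by simp
  ultimately show ?thesis
    by (simp add: decode_def)
qed

text \<open>Digits 0 to m of three interleaved coordinates occupy the first 3 * (m + 1)
  positions.\<close>

lemma prefix_determined_decode:
  assumes "j < 3"
  shows "prefix_determined (3 * Suc m) (decode j m)"
  unfolding prefix_determined_def decode_def
  using assms by (intro allI impI arg_cong[of _ _ "min 1"] sum.cong) auto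

lemma decode_bounds: "0 \<le> decode j m b" "decode j m b \<le> 1"
  by (auto simp: decode_def intro!: sum_nonneg)

lemma decode_mono: "m \<le> n \<Longrightarrow> decode j m b \<le> decode j n b"
  unfolding decode_def by (intro min.mono sum_mono2) auto

text \<open>The partial sums increase with m, so the supremum is their limit; in this form an upper
  bound on the limit is an upper bound on every partial sum.\<close>

definition decode_limit :: "nat \<Rightarrow> (nat \<Rightarrow> bool) \<Rightarrow> real" where
  "decode_limit j b = (SUP m. decode j m b)"

lemma decode_limit_bdd: "bdd_above (range (\<lambda>m. decode j m b))"
  using decode_bounds(2) by (intro bdd_aboveI2)

lemma decode_le_limit: "decode j m b \<le> decode_limit j b"
  unfolding decode_limit_def by (intro cSUP_upper decode_limit_bdd) simp

lemma decode_limit_le_iff: "decode_limit j b \<le> t \<longleftrightarrow> (\<forall>m. decode j m b \<le> t)"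
  unfolding decode_limit_def by (subst cSUP_le_iff) (auto intro: decode_limit_bdd)

lemma decode_limit_bounds: "0 \<le> decode_limit j b" "decode_limit j b \<le> 1"
  using decode_bounds(1)[of j 0 b] decode_le_limit[of j 0 b] decode_bounds(2)[of j _ b]
  by (auto simp: decode_limit_le_iff)

context cube_measure
begin

text \<open>\<rho> is the law of the point decoded from the limiting random digits. Truncated
  coordinates depend on finitely many digits, so their joint laws are limits of those under the
  weights, and for each pair of coordinates these limits are the truncated marginals of
  \<pi>.\<close>

lemma limit_plan:
  assumes opt: "\<And>n. approx_optimal n (I n) (w n) (f n)"
  obtains r \<rho> where "strict_mono r" "\<rho> \<in> borel_prob_measures unit_cube"
    "\<And>a. a \<in> axes \<Longrightarrow> distr \<rho> (restrict_space borel unit_square) (pair_proj a)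
      = distr \<pi> (restrict_space borel unit_square) (pair_proj a)"
    "\<And>e. 0 < e \<Longrightarrow>
      eventually (\<lambda>k. (\<Sum>p\<in>I (r k). w (r k) p * xyz p) \<le> (\<integral>p. xyz p \<partial>\<rho>) + e) sequentially"
proof -
  have I: "finite (I n)" "I n \<subseteq> unit_cube" and w: "p \<in> I n \<Longrightarrow> 0 \<le> w n p" "sum (w n) (I n) = 1"
    and approx: "a \<in> axes \<Longrightarrow> (\<And>s. \<bar>q s\<bar> \<le> 1) \<Longrightarrow>
      \<bar>(\<Sum>p\<in>I n. w n p * q (pair_proj a p)) - (\<integral>p. q (trunc2 n (pair_proj a p)) \<partial>\<pi>)\<bar> \<le> 1 / 2 ^ n"
    for n p a q
    using opt[of n] by (auto simp: approx_optimal_def)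
  obtain r B where r: "strict_mono r" and B: "\<And>n. B n \<in> measurable borel (count_space UNIV)"
    and meas: "\<And>N (F :: _ \<Rightarrow> real). prefix_determined N F \<Longrightarrow> (\<lambda>u. F (\<lambda>n. B n u)) \<in> borel_measurable borel"
    and lim: "\<And>N F. prefix_determined N F \<Longrightarrow>
      (\<lambda>k. \<Sum>p\<in>I (r k). w (r k) p * F (digits3 p)) \<longlonglongrightarrow> (\<integral>u. F (\<lambda>n. B n u) \<partial>unit_uniform)"
    by (rule cantor_compactness[where \<beta> = digits3, OF I(1) _ w(2)]) ((rule w(1) | rule that); assumption)+
  note [measurable] = B
  interpret U: prob_space unit_uniform by (rule prob_space_unit_uniform)
  define X where "X j m u = decode j m (\<lambda>n. B n u)" for j m u
  define Y where "Y j u = decode_limit j (\<lambda>n. B n u)" for j u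
  have X_meas [measurable]: "X j m \<in> borel_measurable borel" for j m
    unfolding X_def decode_def by measurable
  have Y_le_iff: "Y j u \<le> t \<longleftrightarrow> (\<forall>m. X j m u \<le> t)" for j u t
    by (simp add: Y_def X_def decode_limit_le_iff)
  have Y_meas [measurable]: "Y j \<in> borel_measurable borel" for j
    by (subst borel_measurable_iff_le) (simp add: Y_le_iff)
  define P where "P u = (Y 0 u, Y 1 u, Y 2 u)" for u
  have P_cube: "P u \<in> unit_cube" for u
    by (auto simp: P_def unit_cube_def Y_def decode_limit_bounds)
  have P_borel: "P \<in> borel_measurable borel"
    unfolding P_def by (intro borel_measurable_Pair Y_meas)
  then have P_meas: "P \<in> measurable unit_uniform (restrict_space borel unit_cube)"
    using P_cube by (intro measurable_restrict_space2) (auto simp: measurable_unit_uniform)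
  define \<rho> where "\<rho> = distr unit_uniform (restrict_space borel unit_cube) P"
  have \<rho>: "\<rho> \<in> borel_prob_measures unit_cube"
    using U.prob_space_distr[OF P_meas] by (simp add: borel_prob_measures_def \<rho>_def)
  have coord_P: "coord j (P u) = Y j u" if "j < 3" for j u
  proof -
    have "j = 0 \<or> j = 1 \<or> j = 2" using that by linarith
    then show ?thesis by (auto simp: P_def)
  qed
  have pair_meas: "pair_proj a \<in> measurable M (restrict_space borel unit_square)"
    if "sets M = sets (restrict_space borel unit_cube)" for a M
    unfolding measurable_cong_sets[OF that refl]
    by (intro measurable_restrict_space2 measurable_restrict_space1 borel_measurable_pair_proj)
      (use pair_proj_unit_cube[of _ a] in \<open>auto simp: space_restrict_space\<close>)
  \<comment> \<open>Both events are decreasing intersections of their truncated versions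
    \<open>D m\<close> and \<open>E m\<close>, so it is enough to compare these at each
    level.\<close>
  have marginal: "measure unit_uniform {u. Y i u \<le> s \<and> Y j u \<le> t}
      = measure \<pi> {p \<in> space \<pi>. coord i p \<le> s \<and> coord j p \<le> t}"
    if a: "(i, j) \<in> axes" for i j s t
  proof -
    have ij: "i < 3" "j < 3"
      using a by (auto simp: axes_def)
    define q where "q z = (of_bool (fst z \<le> s \<and> snd z \<le> t) :: real)" for z
    define E where "E m = {p \<in> space \<pi>. trunc m (coord i p) \<le> s \<and> trunc m (coord j p) \<le> t}" for m
    define D where "D m = {u. X i m u \<le> s \<and> X j m u \<le> t}" for m
    have E_sets: "E m \<in> sets \<pi>" for m
      unfolding E_def by measurable
    have D_sets: "D m \<in> sets borel" for m
      unfolding D_def by measurable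
    \<comment> \<open>One sequence has both numbers as limits: one by convergence on
      prefix-determined functions, the other by the marginal condition in
      \<open>approx_optimal\<close>.\<close>
    have "measure unit_uniform (D m) = measure \<pi> (E m)" for m
    proof (rule LIMSEQ_unique)
      let ?F = "\<lambda>b. q (decode i m b, decode j m b)"
      have "prefix_determined (3 * Suc m) ?F"
        using prefix_determined_decode[OF ij(1), of m] prefix_determined_decode[OF ij(2), of m]
        unfolding prefix_determined_def by metis
      from lim[OF this]
      have "(\<lambda>k. \<Sum>p\<in>I (r k). w (r k) p * ?F (digits3 p)) \<longlonglongrightarrow> (\<integral>u. ?F (\<lambda>n. B n u) \<partial>unit_uniform)" .
      also have "(\<integral>u. ?F (\<lambda>n. B n u) \<partial>unit_uniform) = (\<integral>u. indicator (D m) u \<partial>unit_uniform)"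
        by (intro Bochner_Integration.integral_cong) (auto simp: q_def D_def X_def)
      also have "\<dots> = measure unit_uniform (D m)"
        using D_sets by simp
      also have "(\<lambda>k. \<Sum>p\<in>I (r k). w (r k) p * ?F (digits3 p))
          = (\<lambda>k. \<Sum>p\<in>I (r k). w (r k) p * q (trunc2 m (pair_proj (i, j) p)))"
        using I(2) ij
        by (intro ext sum.cong refl) (auto simp: decode_digits3 trunc2_def pair_proj_def subset_iff)
      finally show "(\<lambda>k. \<Sum>p\<in>I (r k). w (r k) p * q (trunc2 m (pair_proj (i, j) p)))
          \<longlonglongrightarrow> measure unit_uniform (D m)" .
      have E_int: "(\<integral>p. q (trunc2 m (pair_proj (i, j) p)) \<partial>\<pi>) = measure \<pi> (E m)"
      proof -
        have "(\<integral>p. q (trunc2 m (pair_proj (i, j) p)) \<partial>\<pi>) = (\<integral>p. indicator (E m) p \<partial>\<pi>)"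
          by (intro Bochner_Integration.integral_cong) (auto simp: q_def E_def trunc2_def pair_proj_def)
        then show ?thesis
          using E_sets by simp
      qed
      show "(\<lambda>k. \<Sum>p\<in>I (r k). w (r k) p * q (trunc2 m (pair_proj (i, j) p))) \<longlonglongrightarrow> measure \<pi> (E m)"
      proof (rule LIM_zero_cancel, rule Lim_null_comparison)
        \<comment> \<open>For m <= k <= r k, truncating to level r k first does not change the
          truncation to level m, so the test function q composed with \<open>trunc2 m\<close> is
          admissible and gives the desired integral.\<close>
        have "\<bar>(\<Sum>p\<in>I (r k). w (r k) p * q (trunc2 m (pair_proj (i, j) p))) - measure \<pi> (E m)\<bar>
            \<le> 1 / 2 ^ r k" if "m \<le> k" for k
          using approx[OF a, of "\<lambda>z. q (trunc2 m z)" "r k"] seq_suble[OF r, of k] that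
          by (simp add: trunc2_trunc2 E_int) (simp add: q_def)
        then show "\<forall>\<^sub>F k in sequentially.
            norm ((\<Sum>p\<in>I (r k). w (r k) p * q (trunc2 m (pair_proj (i, j) p))) - measure \<pi> (E m))
              \<le> 1 / 2 ^ r k"
          by (auto simp: eventually_sequentially)
        have "(\<lambda>n. 1 / 2 ^ n :: real) \<longlonglongrightarrow> 0"
          using LIMSEQ_realpow_zero[of "1 / 2 :: real"] by (simp add: power_one_over)
        from LIMSEQ_subseq_LIMSEQ[OF this r] show "(\<lambda>k. 1 / 2 ^ r k :: real) \<longlonglongrightarrow> 0"
          by (simp add: o_def)
      qed
    qed
    moreover have "(\<lambda>m. measure unit_uniform (D m)) \<longlonglongrightarrow> measure unit_uniform (\<Inter>m. D m)"
    proof (rule U.finite_Lim_measure_decseq)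
      show "decseq D"
        unfolding decseq_def D_def X_def using decode_mono order_trans by blast
    qed (use D_sets in auto)
    moreover have "(\<lambda>m. measure \<pi> (E m)) \<longlonglongrightarrow> measure \<pi> (\<Inter>m. E m)"
    proof (rule finite_Lim_measure_decseq)
      show "decseq E"
        unfolding decseq_def E_def using trunc_mono order_trans by blast
    qed (use E_sets in auto)
    moreover have "(\<Inter>m. D m) = {u. Y i u \<le> s \<and> Y j u \<le> t}"
      by (auto simp: D_def Y_le_iff)
    moreover have "(\<Inter>m. E m) = {p \<in> space \<pi>. (\<forall>m. trunc m (coord i p) \<le> s)
        \<and> (\<forall>m. trunc m (coord j p) \<le> t)}"
      by (auto simp: E_def)
    then have "(\<Inter>m. E m) = {p \<in> space \<pi>. coord i p \<le> s \<and> coord j p \<le> t}"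
      by (simp only: trunc_le_iff)
    ultimately show ?thesis
      using LIMSEQ_unique by simp
  qed
  have "distr \<rho> (restrict_space borel unit_square) (pair_proj a)
      = distr \<pi> (restrict_space borel unit_square) (pair_proj a)" if a: "a \<in> axes" for a
  proof (rule distr_restrict_space_eqI)
    have \<rho>_sets: "sets \<rho> = sets (restrict_space borel unit_cube)"
      by (simp add: \<rho>_def)
    show \<rho>_meas: "pair_proj a \<in> measurable \<rho> (restrict_space borel unit_square)"
      using \<rho>_sets by (rule pair_meas)
    show "pair_proj a \<in> measurable \<pi> (restrict_space borel unit_square)"
      using sets_eq by (rule pair_meas)
    have pair_borel: "pair_proj a \<in> borel_measurable \<rho>" "pair_proj a \<in> borel_measurable \<pi>"
      using \<rho>_sets \<rho>_meas measurable_borel by (auto simp: measurable_restrict_space2_iff)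
    interpret R: prob_space \<rho>
      using \<rho> by (simp add: borel_prob_measures_def)
    show "distr \<rho> borel (pair_proj a) = distr \<pi> borel (pair_proj a)"
    proof (rule measure_eq_on_quadrants)
      fix s t :: real
      obtain i j where [simp]: "a = (i, j)" by fastforce
      have ij: "i < 3" "j < 3"
        using a by (auto simp: axes_def)
      have Q: "{..s} \<times> {..t} \<in> sets borel"
        by (intro borel_closed closed_Times closed_atMost)
      have "distr \<rho> borel (pair_proj a) = distr unit_uniform borel (pair_proj a \<circ> P)"
        unfolding \<rho>_def using P_meas pair_borel(1)
        by (subst distr_distr) (auto simp: \<rho>_def)
      moreover have "pair_proj a \<circ> P \<in> borel_measurable unit_uniform"
        using measurable_comp[OF P_borel borel_measurable_pair_proj] by (simp add: measurable_unit_uniform)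
      moreover have "(pair_proj a \<circ> P) -` ({..s} \<times> {..t}) = {u. Y i u \<le> s \<and> Y j u \<le> t}"
        using ij by (auto simp: pair_proj_def coord_P)
      ultimately have "measure (distr \<rho> borel (pair_proj a)) ({..s} \<times> {..t})
          = measure unit_uniform {u. Y i u \<le> s \<and> Y j u \<le> t}"
        using Q by (simp add: measure_distr)
      also have "\<dots> = measure \<pi> {p \<in> space \<pi>. coord i p \<le> s \<and> coord j p \<le> t}"
        by (rule marginal) (use a in simp)
      also have "{p \<in> space \<pi>. coord i p \<le> s \<and> coord j p \<le> t}
          = pair_proj a -` ({..s} \<times> {..t}) \<inter> space \<pi>"
        by (auto simp: pair_proj_def)
      also have "measure \<pi> \<dots> = measure (distr \<pi> borel (pair_proj a)) ({..s} \<times> {..t})"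
        using Q pair_borel(2) by (simp add: measure_distr)
      finally show "measure (distr \<rho> borel (pair_proj a)) ({..s} \<times> {..t})
          = measure (distr \<pi> borel (pair_proj a)) ({..s} \<times> {..t})" .
    qed (auto intro: prob_space_distr R.prob_space_distr pair_borel)
  qed (rule unit_square_borel)
  moreover have "eventually (\<lambda>k. (\<Sum>p\<in>I (r k). w (r k) p * xyz p) \<le> (\<integral>p. xyz p \<partial>\<rho>) + e) sequentially"
    if "0 < e" for e
  proof -
    have "0 < e / 3"
      using that by simp
    \<comment> \<open>The level is so fine that the truncation error 3/2^m stays below e; the
      remaining slack e - 3/2^m absorbs the convergence in k.\<close>
    then obtain m where "(1 / 2 :: real) ^ m < e / 3"
      using real_arch_pow_inv[of "e / 3" "1 / 2"] by auto
    then have m: "3 / 2 ^ m < e"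
      by (simp add: power_one_over)
    \<comment> \<open>This is xyz after truncation to level m. It depends on finitely many digits,
      is at most xyz at the decoded limit point, and is within 3/2^m of xyz on digits of points of
      the cube.\<close>
    let ?F = "\<lambda>b. decode 0 m b * decode 1 m b * decode 2 m b"
    have "prefix_determined (3 * Suc m) ?F"
      unfolding prefix_determined_def
      by (intro allI impI arg_cong2[of _ _ _ _ "(*)"]
          prefix_determined_decode[unfolded prefix_determined_def, rule_format]) auto
    from meas[OF this] lim[OF this]
    have F: "(\<lambda>u. ?F (\<lambda>n. B n u)) \<in> borel_measurable borel"
        "(\<lambda>k. \<Sum>p\<in>I (r k). w (r k) p * ?F (digits3 p)) \<longlonglongrightarrow> (\<integral>u. ?F (\<lambda>n. B n u) \<partial>unit_uniform)" .
    have "(\<integral>u. ?F (\<lambda>n. B n u) \<partial>unit_uniform) \<le> (\<integral>u. xyz (P u) \<partial>unit_uniform)"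
    proof (rule integral_mono)
      show "integrable unit_uniform (\<lambda>u. ?F (\<lambda>n. B n u))"
        using F(1) decode_bounds
        by (intro U.integrable_const_bound[of _ 1]) (auto simp: measurable_unit_uniform mult_le_one)
      show "integrable unit_uniform (\<lambda>u. xyz (P u))"
      proof (rule U.integrable_const_bound[of _ 1])
        show "(\<lambda>u. xyz (P u)) \<in> borel_measurable unit_uniform"
          using measurable_compose[OF P_borel borel_measurable_xyz] by (simp add: measurable_unit_uniform)
      qed (use xyz_unit_cube[OF P_cube] in auto)
      show "?F (\<lambda>n. B n u) \<le> xyz (P u)" for u
        using decode_bounds decode_le_limit decode_limit_bounds
        by (auto simp: P_def xyz_def Y_def intro!: mult_mono)
    qed
    also have "(\<integral>u. xyz (P u) \<partial>unit_uniform) = (\<integral>p. xyz p \<partial>\<rho>)"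
      unfolding \<rho>_def using P_meas by (subst integral_distr) (auto intro: measurable_restrict_space1)
    finally have "(\<integral>u. ?F (\<lambda>n. B n u) \<partial>unit_uniform) < (\<integral>p. xyz p \<partial>\<rho>) + (e - 3 / 2 ^ m)"
      using m by linarith
    from order_tendstoD(2)[OF F(2) this] show ?thesis
    proof eventually_elim
      case (elim k)
      have "(\<Sum>p\<in>I (r k). w (r k) p * xyz p) \<le> (\<Sum>p\<in>I (r k). w (r k) p * (?F (digits3 p) + 3 / 2 ^ m))"
      proof (intro sum_mono mult_left_mono)
        fix p assume p: "p \<in> I (r k)"
        then have "p \<in> unit_cube"
          using I(2) by blast
        then have "xyz (trunc3 m p) = ?F (digits3 p)"
          by (cases p) (simp add: decode_digits3 trunc3_def xyz_def)
        then show "xyz p \<le> ?F (digits3 p) + 3 / 2 ^ m"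
          using xyz_trunc3(2)[OF \<open>p \<in> unit_cube\<close>, of m] by simp
      qed (use w in auto)
      also have "\<dots> = (\<Sum>p\<in>I (r k). w (r k) p * ?F (digits3 p)) + 3 / 2 ^ m"
        using w(2)[of "r k"] by (simp only: distrib_left sum.distrib sum_distrib_right[symmetric])
      finally show ?case
        using elim by simp
    qed
  qed
  ultimately show thesis
    using that r \<rho> by blast
qed

end

section \<open>Dual functions and competitors\<close>

lemma competitor_pair_proj:
  assumes "competitor G G'" "a \<in> axes"
  shows "map_pmf (pair_proj a) (pmf_of_set G') = map_pmf (pair_proj a) (pmf_of_set G)"
  using assms unfolding competitor_def axes_def by (elim insertE) (simp_all only: pair_proj_simps empty_iff)

text \<open>Equal push-forwards have equal supports, so G' projects into the unit square, and the
  xy- and yz-planes together see all coordinates. Dual inequalities, which hold on the cube, thus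
  apply to competitors too.\<close>

lemma competitor_unit_cube:
  assumes "competitor G G'" "G \<subseteq> unit_cube"
  shows "G' \<subseteq> unit_cube"
proof
  fix p assume p: "p \<in> G'"
  have "pair_proj a p \<in> unit_square" if "a \<in> axes" for a
  proof -
    have "pair_proj a ` G' = pair_proj a ` G"
      using arg_cong[OF competitor_pair_proj[OF assms(1) that], of set_pmf] assms(1)
      by (simp add: competitor_def)
    with p assms(2) pair_proj_unit_cube[of _ a] show ?thesis
      by (metis imageE imageI subsetD)
  qed
  from this[of "(0, 1)"] this[of "(1, 2)"] show "p \<in> unit_cube"
    by (cases p) (auto simp: axes_def pair_proj_def unit_square_def unit_cube_def)
qed

text \<open>Weak duality: a sum of functions of the three projections has the same integral over G'
  as over G.\<close>

lemma competitor_integral_le: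
  assumes comp: "competitor G G'" and G: "G \<subseteq> unit_cube"
    and f: "\<And>p. p \<in> unit_cube \<Longrightarrow> xyz p \<le> (\<Sum>a\<in>axes. f a (pair_proj a p))"
  shows "(\<integral>p. xyz p \<partial>measure_pmf (pmf_of_set G'))
    \<le> (\<integral>p. (\<Sum>a\<in>axes. f a (pair_proj a p)) \<partial>measure_pmf (pmf_of_set G))"
proof -
  have fin: "finite G" "G \<noteq> {}" "finite G'" "G' \<noteq> {}"
    using comp by (auto simp: competitor_def)
  then have int: "integrable (measure_pmf (pmf_of_set G)) h" "integrable (measure_pmf (pmf_of_set G')) h"
    for h :: "point3 \<Rightarrow> real"
    by (simp_all add: integrable_measure_pmf_finite set_pmf_of_set)
  have "(\<integral>p. xyz p \<partial>measure_pmf (pmf_of_set G'))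
      \<le> (\<integral>p. (\<Sum>a\<in>axes. f a (pair_proj a p)) \<partial>measure_pmf (pmf_of_set G'))"
    using competitor_unit_cube[OF comp G] f fin
    by (intro integral_mono_AE int) (auto simp: AE_measure_pmf_iff)
  also have "\<dots> = (\<Sum>a\<in>axes. \<integral>s. f a s \<partial>measure_pmf (map_pmf (pair_proj a) (pmf_of_set G')))"
    using int by simp
  also have "\<dots> = (\<Sum>a\<in>axes. \<integral>s. f a s \<partial>measure_pmf (map_pmf (pair_proj a) (pmf_of_set G)))"
    using competitor_pair_proj[OF comp] by (intro sum.cong) auto
  also have "\<dots> = (\<integral>p. (\<Sum>a\<in>axes. f a (pair_proj a p)) \<partial>measure_pmf (pmf_of_set G))"
    using int by simp
  finally show ?thesis .
qed

text \<open>Pass to the limit in \<open>competitor_integral_le\<close>. The bound involves the dual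
  functions only on the finite set G, where pointwise convergence gives convergence of integrals; on
  G' only the inequality is used.\<close>

lemma cyclical_monotone_dual_limit:
  fixes f :: "nat \<Rightarrow> nat \<times> nat \<Rightarrow> real \<times> real \<Rightarrow> real"
  assumes f: "\<And>k p. p \<in> unit_cube \<Longrightarrow> xyz p \<le> (\<Sum>a\<in>axes. f k a (pair_proj a p))"
  shows "cyclical_monotone {p \<in> unit_cube. (\<lambda>k. \<Sum>a\<in>axes. f k a (pair_proj a p)) \<longlonglongrightarrow> xyz p}"
  unfolding cyclical_monotone_def
proof (intro allI impI)
  fix n G G'
  assume G: "G \<subseteq> {p \<in> unit_cube. (\<lambda>k. \<Sum>a\<in>axes. f k a (pair_proj a p)) \<longlonglongrightarrow> xyz p} \<and> card G = n"
    and comp: "competitor G G'"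
  then have fin: "finite G" "G \<noteq> {}"
    by (auto simp: competitor_def)
  show "(\<integral>p. xyz p \<partial>measure_pmf (pmf_of_set G')) \<le> (\<integral>p. xyz p \<partial>measure_pmf (pmf_of_set G))"
  proof (rule LIMSEQ_le_const)
    show "(\<lambda>k. \<integral>p. (\<Sum>a\<in>axes. f k a (pair_proj a p)) \<partial>measure_pmf (pmf_of_set G))
        \<longlonglongrightarrow> (\<integral>p. xyz p \<partial>measure_pmf (pmf_of_set G))"
      unfolding integral_pmf_of_set[OF fin(2,1)]
      by (intro tendsto_divide tendsto_sum tendsto_const) (use G fin in auto)
    show "\<exists>N. \<forall>k\<ge>N. (\<integral>p. xyz p \<partial>measure_pmf (pmf_of_set G'))
        \<le> (\<integral>p. (\<Sum>a\<in>axes. f k a (pair_proj a p)) \<partial>measure_pmf (pmf_of_set G))"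
      using competitor_integral_le[OF comp, of "f _"] f G by blast
  qed
qed

section \<open>The set of full measure for an optimal plan\<close>

theorem theorem4p4:
  fixes \<mu>12 \<mu>13 \<mu>23 :: "(real \<times> real) measure"
    and \<pi> :: "(real \<times> real \<times> real) measure"
  assumes "\<mu>12 \<in> borel_prob_measures unit_square"
    and "\<mu>13 \<in> borel_prob_measures unit_square"
    and "\<mu>23 \<in> borel_prob_measures unit_square"
    and "plans \<mu>12 \<mu>23 \<mu>13 \<noteq> {}"
    and "is_arg_max (\<lambda>\<rho>. \<integral>p. xyz p \<partial>\<rho>) (\<lambda>\<rho>. \<rho> \<in> plans \<mu>12 \<mu>23 \<mu>13) \<pi>"
  shows "\<exists>\<Gamma> :: (real \<times> real \<times> real) set. cyclical_monotone \<Gamma> \<and> emeasure \<pi> \<Gamma> = 1"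
proof -
  have plan: "\<pi> \<in> plans \<mu>12 \<mu>23 \<mu>13"
    and opt: "\<And>\<rho>. \<rho> \<in> plans \<mu>12 \<mu>23 \<mu>13 \<Longrightarrow> (\<integral>p. xyz p \<partial>\<rho>) \<le> (\<integral>p. xyz p \<partial>\<pi>)"
    using assms(5) by (auto simp: is_arg_max_def not_less)
  interpret cube_measure \<pi>
    using plan by (simp add: cube_measure_def cube_measure_axioms_def plans_def borel_prob_measures_def)
  obtain I w f where D: "\<And>n. approx_optimal n (I n) (w n) (f n)"
    using approx_optimal_exists by metis
  obtain r \<rho> where r: "strict_mono r" and \<rho>: "\<rho> \<in> borel_prob_measures unit_cube"
    and marginals: "\<And>a. a \<in> axes \<Longrightarrow> distr \<rho> (restrict_space borel unit_square) (pair_proj a)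
      = distr \<pi> (restrict_space borel unit_square) (pair_proj a)"
    and limsup: "\<And>e. 0 < e \<Longrightarrow>
      eventually (\<lambda>k. (\<Sum>p\<in>I (r k). w (r k) p * xyz p) \<le> (\<integral>p. xyz p \<partial>\<rho>) + e) sequentially"
    by (rule limit_plan[OF D]) (rule that; assumption)
  have "\<rho> \<in> plans \<mu>12 \<mu>23 \<mu>13"
    using plan \<rho> marginals[of "(0, 1)"] marginals[of "(1, 2)"] marginals[of "(0, 2)"]
    unfolding plans_def pair_proj_simps by (simp add: axes_def)
  note \<rho>_le = opt[OF this]
  \<comment> \<open>The slack of the dual inequality is nonnegative on the cube, so its L1 norm is
    the dual value minus the optimal value.\<close>
  define \<phi> where "\<phi> k p = (\<Sum>a\<in>axes. f (r k) a (pair_proj a p)) - xyz p" for k p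
  have int_f: "integrable \<pi> (\<lambda>p. \<Sum>a\<in>axes. f n a (pair_proj a p))" for n
    using D[of n] by (intro Bochner_Integration.integrable_sum) (auto simp: approx_optimal_def)
  have int_\<phi>: "integrable \<pi> (\<phi> k)" for k
    unfolding \<phi>_def using int_f integrable_xyz by (intro Bochner_Integration.integrable_diff)
  have \<phi>_nonneg: "0 \<le> \<phi> k p" if "p \<in> unit_cube" for k p
    using D[of "r k"] that by (auto simp: approx_optimal_def \<phi>_def)
  have norm_\<phi>: "(\<integral>p. norm (\<phi> k p) \<partial>\<pi>) = (\<integral>p. \<phi> k p \<partial>\<pi>)" for k
    using \<phi>_nonneg by (intro Bochner_Integration.integral_cong) (auto simp: space_eq)
  \<comment> \<open>Optimality of \<pi> enters here: the dual value at level r k is at most the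
    integral of xyz over \<rho> plus a vanishing error, and \<rho> is a plan, so it does not beat
    \<pi>.\<close>
  have "(\<lambda>k. \<integral>p. norm (\<phi> k p) \<partial>\<pi>) \<longlonglongrightarrow> 0"
  proof (rule order_tendstoI)
    fix e :: real assume "e < 0"
    moreover have "0 \<le> (\<integral>p. norm (\<phi> k p) \<partial>\<pi>)" for k
      by (rule Bochner_Integration.integral_nonneg) simp
    ultimately show "eventually (\<lambda>k. e < (\<integral>p. norm (\<phi> k p) \<partial>\<pi>)) sequentially"
      by (intro always_eventually allI) (rule less_le_trans)
  next
    fix e :: real assume e: "0 < e"
    have "(\<lambda>n. 3 * (1 / 2 ^ n :: real)) \<longlonglongrightarrow> 3 * 0"
      using LIMSEQ_realpow_zero[of "1 / 2 :: real"] by (intro tendsto_mult) (simp_all add: power_one_over)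
    from LIMSEQ_subseq_LIMSEQ[OF this r] have "(\<lambda>k. 3 / 2 ^ r k :: real) \<longlonglongrightarrow> 0"
      by (simp add: o_def)
    then have "eventually (\<lambda>k. 3 / 2 ^ r k < e / 2) sequentially"
      using e by (intro order_tendstoD) auto
    moreover have "eventually (\<lambda>k. (\<Sum>p\<in>I (r k). w (r k) p * xyz p) \<le> (\<integral>p. xyz p \<partial>\<rho>) + e / 2) sequentially"
      using e by (intro limsup) simp
    ultimately show "eventually (\<lambda>k. (\<integral>p. norm (\<phi> k p) \<partial>\<pi>) < e) sequentially"
    proof eventually_elim
      case (elim k)
      have "(\<integral>p. \<phi> k p \<partial>\<pi>) = (\<integral>p. (\<Sum>a\<in>axes. f (r k) a (pair_proj a p)) \<partial>\<pi>) - (\<integral>p. xyz p \<partial>\<pi>)"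
        unfolding \<phi>_def using int_f integrable_xyz by (rule Bochner_Integration.integral_diff)
      moreover have "(\<integral>p. (\<Sum>a\<in>axes. f (r k) a (pair_proj a p)) \<partial>\<pi>)
          \<le> (\<Sum>p\<in>I (r k). w (r k) p * xyz p) + 3 / 2 ^ r k"
        using D[of "r k"] unfolding approx_optimal_def by blast
      ultimately show ?case
        using elim \<rho>_le norm_\<phi>[of k] by linarith
    qed
  qed
  \<comment> \<open>Convergence in L1 yields convergence almost everywhere only after passing to a
    further subsequence.\<close>
  from tendsto_L1_AE_subseq[OF int_\<phi> this] obtain r' :: "nat \<Rightarrow> nat"
    where ae: "AE p in \<pi>. (\<lambda>k. \<phi> (r' k) p) \<longlonglongrightarrow> 0"
    by blast
  define \<Gamma> where "\<Gamma> = {p \<in> unit_cube. (\<lambda>k. \<Sum>a\<in>axes. f (r (r' k)) a (pair_proj a p)) \<longlonglongrightarrow> xyz p}"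
  have "cyclical_monotone \<Gamma>"
    unfolding \<Gamma>_def using D by (intro cyclical_monotone_dual_limit) (simp add: approx_optimal_def)
  moreover have "emeasure \<pi> \<Gamma> = 1"
  proof -
    \<comment> \<open>Written through the measurable functions \<phi>, \<Gamma> is seen to be
      measurable.\<close>
    have \<Gamma>: "\<Gamma> = {p \<in> space \<pi>. (\<lambda>k. \<phi> (r' k) p) \<longlonglongrightarrow> 0}"
      by (simp add: \<Gamma>_def \<phi>_def space_eq LIM_zero_iff)
    have [measurable]: "\<phi> k \<in> borel_measurable \<pi>" for k
      using int_\<phi> by (rule borel_measurable_integrable)
    have "\<Gamma> \<in> sets \<pi>"
      unfolding \<Gamma> by measurable
    moreover have "AE p in \<pi>. p \<in> \<Gamma>"
      using ae AE_space by eventually_elim (simp add: \<Gamma>)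
    ultimately show ?thesis
      by (rule emeasure_eq_1_AE)
  qed
  ultimately show ?thesis
    by blast
qed

end
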